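(* Assume that the Goldberg–Seymour conjecture is true, i.e. every graph $K$ with $\chi'(K)>\Delta(K)+1$ satisfies $\chi'(K)=\lceil\rho(K)\rceil$. If $G$ is a graph satisfying $\chi'(G)\geq \max\{\Delta(G)+2,\ |V(G)|+1\}$, then $\chi''(G)=\chi'(G)$.
   Context: Graphs are finite and may contain multiple (parallel) edges but no loops. $V(G)$ and $E(G)$ are the vertex set and edge set of $G$, and $\Delta(G)$ is the maximum degree of $G$ (degrees count edges with multiplicity). A $k$-edge-coloring of $G$ is an assignment of $k$ colors to the edges such that no two edges sharing an endpoint (including parallel edges) receive the same color; the chromatic index $\chi'(G)$ is the least $k\ge 0$ for which $G$ has a $k$-edge-coloring. A total $k$-coloring of $G$ is an assignment of $k$ colors to the vertices and edges such that no two adjacent or incident elements of $V(G)\cup E(G)$ receive the same color; the total chromatic number $\chi''(G)$ is the least $k\ge 0$ for which $G$ has a total $k$-coloring. The density of $G$ is $\rho(G)=\max\left\{\frac{2|E(H)|}{|V(H)|-1} : H\subseteq G,\ |V(H)|\geq 3 \text{ odd}\right\}$. *)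

theory Defs
  imports Complex_Main
begin

record ('a, 'b) mgraph =
  verts :: "'a set"
  edges :: "'b set"
  ends :: "'b \<Rightarrow> 'a set"

text \<open>Edges are named objects, so that parallel edges are distinct edges with equal
  \<open>ends\<close>; the condition \<open>card (ends G e) = 2\<close> excludes loops.\<close>

definition multigraph :: "('a, 'b) mgraph \<Rightarrow> bool" where
  "multigraph G \<longleftrightarrow> finite (verts G) \<and> finite (edges G) \<and>
     (\<forall>e\<in>edges G. ends G e \<subseteq> verts G \<and> card (ends G e) = 2)"

definition subgraph :: "('a, 'b) mgraph \<Rightarrow> ('a, 'b) mgraph \<Rightarrow> bool" where
  "subgraph H G \<longleftrightarrow> multigraph H \<and> verts H \<subseteq> verts G \<and> edges H \<subseteq> edges G \<and>
     (\<forall>e\<in>edges H. ends H e = ends G e)"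

definition degree :: "('a, 'b) mgraph \<Rightarrow> 'a \<Rightarrow> nat" where
  "degree G v = card {e \<in> edges G. v \<in> ends G e}"

text \<open>Here and in \<open>density\<close>, inserting \<open>0\<close> only fixes the value of the maximum over an
  empty set (no vertices, resp. fewer than three vertices): all other members are
  nonnegative.\<close>

definition max_degree :: "('a, 'b) mgraph \<Rightarrow> nat" where
  "max_degree G = Max (insert 0 (degree G ` verts G))"

definition density :: "('a, 'b) mgraph \<Rightarrow> real" where
  "density G = Max (insert 0
     {2 * real (card (edges H)) / (real (card (verts H)) - 1) | H.
        subgraph H G \<and> card (verts H) \<ge> 3 \<and> odd (card (verts H))})"

definition edge_coloring :: "('a, 'b) mgraph \<Rightarrow> nat \<Rightarrow> ('b \<Rightarrow> nat) \<Rightarrow> bool" where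
  "edge_coloring G k c \<longleftrightarrow> (\<forall>e\<in>edges G. c e < k) \<and>
     (\<forall>e\<in>edges G. \<forall>f\<in>edges G. e \<noteq> f \<and> ends G e \<inter> ends G f \<noteq> {} \<longrightarrow> c e \<noteq> c f)"

definition chromatic_index :: "('a, 'b) mgraph \<Rightarrow> nat" where
  "chromatic_index G = (LEAST k. \<exists>c. edge_coloring G k c)"

fun adjacent_or_incident :: "('a, 'b) mgraph \<Rightarrow> 'a + 'b \<Rightarrow> 'a + 'b \<Rightarrow> bool" where
  "adjacent_or_incident G (Inl u) (Inl v) \<longleftrightarrow> u \<noteq> v \<and> (\<exists>e\<in>edges G. ends G e = {u, v})"
| "adjacent_or_incident G (Inl v) (Inr e) \<longleftrightarrow> v \<in> ends G e"
| "adjacent_or_incident G (Inr e) (Inl v) \<longleftrightarrow> v \<in> ends G e"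
| "adjacent_or_incident G (Inr e) (Inr f) \<longleftrightarrow> e \<noteq> f \<and> ends G e \<inter> ends G f \<noteq> {}"

definition total_coloring :: "('a, 'b) mgraph \<Rightarrow> nat \<Rightarrow> ('a + 'b \<Rightarrow> nat) \<Rightarrow> bool" where
  "total_coloring G k c \<longleftrightarrow> (\<forall>x \<in> verts G <+> edges G. c x < k) \<and>
     (\<forall>x \<in> verts G <+> edges G. \<forall>y \<in> verts G <+> edges G.
        adjacent_or_incident G x y \<longrightarrow> c x \<noteq> c y)"

definition total_chromatic_number :: "('a, 'b) mgraph \<Rightarrow> nat" where
  "total_chromatic_number G = (LEAST k. \<exists>c. total_coloring G k c)"

text \<open>The sets of which the two chromatic parameters are least elements are nonempty, and
  the set in \<open>density\<close> is finite.\<close>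

lemma ex_total_coloring:
  assumes "multigraph G"
  shows "\<exists>k c. total_coloring G k c"
proof -
  have "finite (verts G <+> edges G)"
    using assms by (simp add: multigraph_def)
  then obtain c :: "'a + 'b \<Rightarrow> nat" and n
    where c: "c ` (verts G <+> edges G) = {i. i < n}" "inj_on c (verts G <+> edges G)"
    using finite_imp_inj_to_nat_seg by metis
  have irrefl: "x \<noteq> y" if "adjacent_or_incident G x y" for x y
    using that by (cases "(G, x, y)" rule: adjacent_or_incident.cases) auto
  have "total_coloring G n c"
    unfolding total_coloring_def using c irrefl by (fastforce dest: inj_onD)
  then show ?thesis by blast
qed

lemma ex_edge_coloring:
  assumes "multigraph G"
  shows "\<exists>k c. edge_coloring G k c"
proof -
  obtain k c where "total_coloring G k c"
    using ex_total_coloring[OF assms] by blast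
  then have "edge_coloring G k (c \<circ> Inr)"
    by (auto simp: total_coloring_def edge_coloring_def InrI)
  then show ?thesis by blast
qed

lemma finite_density_set:
  assumes "multigraph G"
  shows "finite {2 * real (card (edges H)) / (real (card (verts H)) - 1) | H.
    subgraph H G \<and> card (verts H) \<ge> 3 \<and> odd (card (verts H))}" (is "finite ?S")
proof (rule finite_subset)
  show "?S \<subseteq> (\<lambda>(E, V). 2 * real (card E) / (real (card V) - 1)) `
      (Pow (edges G) \<times> Pow (verts G))"
    by (force simp: subgraph_def)
  show "finite ((\<lambda>(E, V). 2 * real (card E) / (real (card V) - 1)) `
      (Pow (edges G) \<times> Pow (verts G)))"
    using assms by (simp add: multigraph_def)
qed

end

theory Submission
  imports Defs
begin

text \<open>Join a new vertex \<open>w\<close> to every vertex of \<open>G\<close> by a single edge. Reading the colour of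
  the edge \<open>wv\<close> as the colour of \<open>v\<close> turns an edge colouring of this cone into a total
  colouring of \<open>G\<close>. With \<open>k = \<chi>'(G)\<close> the cone has maximum degree
  \<open>max (\<Delta>(G) + 1) |V(G)| < k\<close>, so by Goldberg--Seymour it is \<open>k\<close>-edge-colourable unless it
  has an odd subgraph \<open>H\<close> with \<open>2|E(H)| > k(|V(H)| - 1)\<close>. If \<open>H\<close> avoids \<open>w\<close>, this
  contradicts the \<open>k\<close>-edge-colourability of \<open>G\<close>; otherwise
  \<open>2|E(H)| \<le> (\<Delta>(G) + 2)(|V(H)| - 1)\<close> by counting degrees.\<close>

section \<open>Degrees and edge colourings\<close>

lemma degree_le_max_degree:
  assumes "multigraph G" "v \<in> verts G"
  shows "degree G v \<le> max_degree G"
  using assms by (simp add: max_degree_def multigraph_def)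

lemma max_degree_le:
  assumes "multigraph G" "\<And>v. v \<in> verts G \<Longrightarrow> degree G v \<le> d"
  shows "max_degree G \<le> d"
  using assms by (simp add: max_degree_def multigraph_def)

lemma degree_subgraph_le:
  assumes "multigraph G" "subgraph H G"
  shows "degree H v \<le> degree G v"
  unfolding degree_def
  by (rule card_mono) (use assms in \<open>auto simp: multigraph_def subgraph_def\<close>)

lemma subgraph_ends_subset:
  assumes "subgraph H G" "e \<in> edges H"
  shows "ends G e \<subseteq> verts H"
proof -
  have "multigraph H" "ends H e = ends G e"
    using assms by (simp_all add: subgraph_def)
  with assms(2) show ?thesis
    by (metis multigraph_def)
qed

lemma handshake:
  assumes "multigraph G"
  shows "(\<Sum>v\<in>verts G. degree G v) = 2 * card (edges G)"
proof -
  have "{v \<in> verts G. v \<in> ends G e} = ends G e" if "e \<in> edges G" for e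
    using assms that by (auto simp: multigraph_def)
  then have "\<forall>e\<in>edges G. card {v \<in> verts G. v \<in> ends G e} = 2"
    using assms by (simp add: multigraph_def)
  then have "(\<Sum>v\<in>verts G. card {e \<in> edges G. v \<in> ends G e}) = (\<Sum>e\<in>edges G. 2)"
    using assms by (intro sum_multicount_gen) (auto simp: multigraph_def)
  then show ?thesis
    by (simp add: degree_def)
qed

text \<open>Sum the degrees in \<open>H\<close>, each of which is at most
  \<open>max_degree G\<close>. This is the estimate for subgraphs of the cone that contain the
  apex.\<close>

lemma card_edges_subgraph_le:
  assumes "multigraph G" "subgraph H G"
  shows "2 * card (edges H) \<le> max_degree G * card (verts H)"
proof -
  have "degree H v \<le> max_degree G" if "v \<in> verts H" for v
    using degree_subgraph_le[OF assms, of v] degree_le_max_degree[OF assms(1), of v] that assms(2)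
    by (auto simp: subgraph_def)
  then have "(\<Sum>v\<in>verts H. degree H v) \<le> card (verts H) * max_degree G"
    using sum_bounded_above[of "verts H" "degree H" "max_degree G"] by simp
  then show ?thesis
    using assms(2) by (simp add: handshake subgraph_def mult.commute)
qed

lemma edge_coloring_mono:
  assumes "edge_coloring G k c" "k \<le> l"
  shows "edge_coloring G l c"
  using assms by (fastforce simp: edge_coloring_def)

lemma edge_coloring_subgraph:
  assumes "edge_coloring G k c" "subgraph H G"
  shows "edge_coloring H k c"
  unfolding edge_coloring_def
proof (intro conjI ballI impI)
  show "c e < k" if "e \<in> edges H" for e
    using that assms by (auto simp: edge_coloring_def subgraph_def)
  fix e f assume "e \<in> edges H" "f \<in> edges H" "e \<noteq> f \<and> ends H e \<inter> ends H f \<noteq> {}"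
  moreover from this have "e \<in> edges G" "f \<in> edges G" "ends H e = ends G e" "ends H f = ends G f"
    using assms(2) by (auto simp: subgraph_def)
  ultimately show "c e \<noteq> c f"
    using assms(1) unfolding edge_coloring_def by metis
qed

lemma edge_coloring_chromatic_index:
  assumes "multigraph G"
  shows "\<exists>c. edge_coloring G (chromatic_index G) c"
  unfolding chromatic_index_def by (rule LeastI_ex) (rule ex_edge_coloring[OF assms])

text \<open>A colour class is a matching: its edges have pairwise disjoint two-element end sets, all
  inside \<open>verts G\<close>.\<close>

lemma card_color_class_le:
  assumes "multigraph G" "edge_coloring G k c"
  shows "2 * card {e \<in> edges G. c e = i} \<le> card (verts G)"
proof -
  let ?M = "{e \<in> edges G. c e = i}"
  have sub: "(\<Union>e\<in>?M. ends G e) \<subseteq> verts G"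
    using assms(1) by (auto simp: multigraph_def)
  have fin: "finite (ends G e)" if "e \<in> ?M" for e
    using assms(1) that by (auto simp: multigraph_def dest: finite_subset)
  have disj: "ends G e \<inter> ends G f = {}" if "e \<in> ?M" "f \<in> ?M" "e \<noteq> f" for e f
    using assms(2) that by (force simp: edge_coloring_def)
  have "card (\<Union>e\<in>?M. ends G e) = (\<Sum>e\<in>?M. card (ends G e))"
    using assms(1) fin disj by (intro card_UN_disjoint) (auto simp: multigraph_def)
  also have "\<dots> = 2 * card ?M"
    using assms(1) by (simp add: multigraph_def)
  finally show ?thesis
    using card_mono[OF _ sub] assms(1) by (simp add: multigraph_def)
qed

text \<open>On an odd number of vertices every matching misses a vertex, so each of the
  \<open>k\<close> colour classes loses one half in the bound; adding up the classes counts every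
  edge once.\<close>

lemma edge_coloring_odd_bound:
  assumes "multigraph G" "edge_coloring G k c" "odd (card (verts G))"
  shows "2 * card (edges G) \<le> k * (card (verts G) - 1)"
proof -
  have "2 * card {e \<in> edges G. c e = i} \<le> card (verts G) - 1" for i
    using card_color_class_le[OF assms(1,2), of i] assms(3) by presburger
  then have "(\<Sum>i<k. 2 * card {e \<in> edges G. c e = i}) \<le> k * (card (verts G) - 1)"
    using sum_bounded_above[of "{..<k}" "\<lambda>i. 2 * card {e \<in> edges G. c e = i}"] by simp
  moreover have "(\<Sum>i<k. card {e \<in> edges G. c e = i}) = (\<Sum>e\<in>edges G. 1)"
  proof (rule sum_multicount_gen)
    have "{i \<in> {..<k}. c e = i} = {c e}" if "e \<in> edges G" for e
      using assms(2) that by (auto simp: edge_coloring_def)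
    then show "\<forall>e\<in>edges G. card {i \<in> {..<k}. c e = i} = 1"
      by simp
  qed (use assms(1) in \<open>auto simp: multigraph_def\<close>)
  ultimately show ?thesis
    by (simp flip: sum_distrib_left)
qed

section \<open>The Goldberg--Seymour conjecture for arbitrary vertex and edge types\<close>

text \<open>The conjecture turned into a sufficient condition for colourability. If \<open>k\<close>
  colours failed, then \<open>chromatic_index K > k \<ge> max_degree K + 1\<close>, so the
  conjecture would give \<open>\<lceil>density K\<rceil> > k\<close>. The premise
  \<open>sparse\<close> says that the density is at most \<open>k\<close>, with denominators
  cleared.\<close>

lemma Goldberg_Seymour_edge_coloring:
  fixes K :: "('a, 'b) mgraph"
  assumes GS: "chromatic_index K > max_degree K + 1 \<Longrightarrow> int (chromatic_index K) = \<lceil>density K\<rceil>"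
    and K: "multigraph K"
    and deg: "max_degree K < k"
    and sparse: "\<And>H. subgraph H K \<Longrightarrow> odd (card (verts H)) \<Longrightarrow>
      2 * card (edges H) \<le> k * (card (verts H) - 1)"
  shows "\<exists>c. edge_coloring K k c"
proof (rule ccontr)
  assume "\<nexists>c. edge_coloring K k c"
  then have less: "k < chromatic_index K"
    using edge_coloring_chromatic_index[OF K] edge_coloring_mono by (metis not_le)
  let ?D = "{2 * real (card (edges H)) / (real (card (verts H)) - 1) | H.
     subgraph H K \<and> card (verts H) \<ge> 3 \<and> odd (card (verts H))}"
  have "x \<le> real k" if x: "x \<in> ?D" for x
  proof -
    obtain H where H: "x = 2 * real (card (edges H)) / (real (card (verts H)) - 1)"
      "subgraph H K" "card (verts H) \<ge> 3" "odd (card (verts H))"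
      using x by blast
    have "real (2 * card (edges H)) \<le> real (k * (card (verts H) - 1))"
      using sparse[OF H(2,4)] by (rule of_nat_mono)
    with H(1,3) show ?thesis
      by (simp add: divide_le_eq of_nat_diff)
  qed
  \<comment> \<open>The default member \<open>0\<close> of the maximum does no harm, since
    \<open>0 \<le> k\<close>.\<close>
  then have "density K \<le> real k"
    unfolding density_def using finite_density_set[OF K] by (subst Max_le_iff) auto
  then have "\<lceil>density K\<rceil> \<le> int k"
    by (simp add: ceiling_le_iff)
  with GS less deg show False
    by simp
qed

section \<open>Invariance under renaming vertices and edges\<close>

definition relabel :: "('a \<Rightarrow> 'c) \<Rightarrow> ('b \<Rightarrow> 'd) \<Rightarrow> ('a, 'b) mgraph \<Rightarrow> ('c, 'd) mgraph" where
  "relabel f g G = \<lparr>verts = f ` verts G, edges = g ` edges G,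
     ends = (\<lambda>e. f ` ends G (inv_into (edges G) g e))\<rparr>"

text \<open>The conjecture is assumed for graphs over \<open>nat\<close> only, whereas the cone
  lives on other types. Injectivity is asked on the finite sets \<open>verts G\<close> and
  \<open>edges G\<close> alone, because the types themselves may be too large to embed in
  \<open>nat\<close>.\<close>

locale relabelling =
  fixes G :: "('a, 'b) mgraph" and f :: "'a \<Rightarrow> 'c" and g :: "'b \<Rightarrow> 'd"
  assumes multigraph: "multigraph G"
    and inj_f: "inj_on f (verts G)"
    and inj_g: "inj_on g (edges G)"
begin

lemma relabel_simps [simp]:
  "verts (relabel f g G) = f ` verts G"
  "edges (relabel f g G) = g ` edges G"
  "e \<in> edges G \<Longrightarrow> ends (relabel f g G) (g e) = f ` ends G e"
  by (simp_all add: relabel_def inj_g)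

lemma ends_subset: "e \<in> edges G \<Longrightarrow> ends G e \<subseteq> verts G"
  using multigraph by (simp add: multigraph_def)

lemma multigraph_relabel: "multigraph (relabel f g G)"
proof -
  have "card (f ` ends G e) = 2" if "e \<in> edges G" for e
    using that multigraph inj_on_subset[OF inj_f ends_subset[OF that]]
    by (simp add: card_image multigraph_def)
  then show ?thesis
    using multigraph ends_subset by (auto simp: multigraph_def)
qed

lemma degree_relabel:
  assumes "v \<in> verts G"
  shows "degree (relabel f g G) (f v) = degree G v"
proof -
  have "f v \<in> f ` ends G e \<longleftrightarrow> v \<in> ends G e" if "e \<in> edges G" for e
    using inj_on_image_mem_iff[OF inj_f assms ends_subset[OF that]] .
  then have "{e \<in> edges (relabel f g G). f v \<in> ends (relabel f g G) e} =
      g ` {e \<in> edges G. v \<in> ends G e}"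
    by auto
  then show ?thesis
    unfolding degree_def using inj_on_subset[OF inj_g] by (simp add: card_image)
qed

lemma max_degree_relabel: "max_degree (relabel f g G) = max_degree G"
  by (simp add: max_degree_def image_image degree_relabel cong: image_cong)

lemma edge_coloring_relabelD:
  assumes "edge_coloring (relabel f g G) k c"
  shows "edge_coloring G k (c \<circ> g)"
  unfolding edge_coloring_def
proof (intro conjI ballI impI)
  show "(c \<circ> g) e < k" if "e \<in> edges G" for e
    using that assms by (simp add: edge_coloring_def)
  fix e e' assume e: "e \<in> edges G" "e' \<in> edges G" "e \<noteq> e' \<and> ends G e \<inter> ends G e' \<noteq> {}"
  then have "g e \<noteq> g e'" "f ` ends G e \<inter> f ` ends G e' \<noteq> {}"
    using inj_g by (auto dest: inj_onD)
  then show "(c \<circ> g) e \<noteq> (c \<circ> g) e'"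
    using assms e(1,2) by (simp add: edge_coloring_def)
qed

text \<open>Pull \<open>H\<close> back along \<open>f\<close> and \<open>g\<close>. Only the two
  cardinalities are recorded, as the sparsity condition depends on nothing else.\<close>

lemma subgraph_relabelD:
  assumes H: "subgraph H (relabel f g G)"
  obtains H' where "subgraph H' G" "card (verts H') = card (verts H)"
    "card (edges H') = card (edges H)"
proof
  let ?H = "\<lparr>verts = {v \<in> verts G. f v \<in> verts H}, edges = {e \<in> edges G. g e \<in> edges H},
    ends = ends G\<rparr>"
  have "f ` ends G e \<subseteq> verts H" if "e \<in> edges G" "g e \<in> edges H" for e
    using that subgraph_ends_subset[OF H that(2)] by simp
  then show "subgraph ?H G"
    using multigraph ends_subset by (auto simp: subgraph_def multigraph_def image_subset_iff)
  have "f ` verts ?H = verts H" "g ` edges ?H = edges H"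
    using H by (auto simp: subgraph_def)
  moreover have "inj_on f (verts ?H)" "inj_on g (edges ?H)"
    by (auto intro: inj_on_subset[OF inj_f] inj_on_subset[OF inj_g])
  ultimately show "card (verts ?H) = card (verts H)" "card (edges ?H) = card (edges H)"
    using card_image[of f "verts ?H"] card_image[of g "edges ?H"] by simp_all
qed

end

text \<open>Rename by injections into \<open>nat\<close>: the maximum degree is unchanged, subgraphs
  pull back with their sizes, and a colouring of the renamed graph composes with
  \<open>g\<close>.\<close>

lemma Goldberg_Seymour_transfer:
  fixes G :: "('a, 'b) mgraph"
  assumes GS: "\<forall>K :: (nat, nat) mgraph. multigraph K \<longrightarrow>
         chromatic_index K > max_degree K + 1 \<longrightarrow>
         int (chromatic_index K) = \<lceil>density K\<rceil>"
    and G: "multigraph G"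
    and deg: "max_degree G < k"
    and sparse: "\<And>H. subgraph H G \<Longrightarrow> odd (card (verts H)) \<Longrightarrow>
      2 * card (edges H) \<le> k * (card (verts H) - 1)"
  shows "\<exists>c. edge_coloring G k c"
proof -
  obtain f :: "'a \<Rightarrow> nat" and g :: "'b \<Rightarrow> nat"
    where "inj_on f (verts G)" "inj_on g (edges G)"
    using G finite_imp_inj_to_nat_seg by (metis multigraph_def)
  with G interpret relabelling G f g
    by unfold_locales
  have "\<exists>c. edge_coloring (relabel f g G) k c"
  proof (rule Goldberg_Seymour_edge_coloring)
    show "max_degree (relabel f g G) < k"
      using deg by (simp add: max_degree_relabel)
    show "2 * card (edges H) \<le> k * (card (verts H) - 1)"
      if "subgraph H (relabel f g G)" "odd (card (verts H))" for H
      using subgraph_relabelD[OF that(1)] sparse that(2) by metis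
  qed (use GS multigraph_relabel in auto)
  then show ?thesis
    using edge_coloring_relabelD by blast
qed

section \<open>The cone over a multigraph\<close>

text \<open>\<open>None\<close> is the apex and \<open>Inl v\<close> names the spoke from it to
  \<open>v\<close>. The edge type is thus the type of elements of \<open>G\<close>, so the same
  function serves as edge colouring of the cone and as total colouring of \<open>G\<close>.\<close>

definition cone :: "('a, 'b) mgraph \<Rightarrow> ('a option, 'a + 'b) mgraph" where
  "cone G = \<lparr>verts = insert None (Some ` verts G), edges = verts G <+> edges G,
     ends = case_sum (\<lambda>v. {None, Some v}) (\<lambda>e. Some ` ends G e)\<rparr>"

lemma cone_simps [simp]:
  "verts (cone G) = insert None (Some ` verts G)"
  "edges (cone G) = verts G <+> edges G"
  "ends (cone G) (Inl v) = {None, Some v}"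
  "ends (cone G) (Inr e) = Some ` ends G e"
  by (simp_all add: cone_def)

lemma multigraph_cone: "multigraph G \<Longrightarrow> multigraph (cone G)"
  by (auto simp: multigraph_def card_image subset_iff image_iff)

lemma degree_cone_None: "degree (cone G) None = card (verts G)"
proof -
  have "{e \<in> edges (cone G). None \<in> ends (cone G) e} = Inl ` verts G"
    by auto
  then show ?thesis
    by (simp add: degree_def card_image)
qed

lemma degree_cone_Some:
  assumes "multigraph G" "v \<in> verts G"
  shows "degree (cone G) (Some v) = degree G v + 1"
proof -
  have "{e \<in> edges (cone G). Some v \<in> ends (cone G) e} =
      {v} <+> {e \<in> edges G. v \<in> ends G e}"
    using assms(2) by auto
  then show ?thesis
    using assms(1) by (simp add: degree_def card_Plus multigraph_def)
qed

lemma max_degree_cone_le: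
  assumes "multigraph G"
  shows "max_degree (cone G) \<le> max (max_degree G + 1) (card (verts G))"
proof (rule max_degree_le[OF multigraph_cone[OF assms]])
  fix x assume "x \<in> verts (cone G)"
  then consider "x = None" | v where "x = Some v" "v \<in> verts G"
    by auto
  then show "degree (cone G) x \<le> max (max_degree G + 1) (card (verts G))"
  proof cases
    case 1
    then show ?thesis by (simp add: degree_cone_None)
  next
    case 2
    then show ?thesis
      using degree_le_max_degree[OF assms] by (simp add: degree_cone_Some[OF assms] le_max_iff_disj)
  qed
qed

text \<open>Adjacent or incident elements of \<open>G\<close> share an end as edges of the cone: two
  spokes meet in \<open>None\<close>, a spoke and an edge at \<open>v\<close> meet in
  \<open>Some v\<close>, and two edges of \<open>G\<close> meet as before.\<close>

lemma total_coloring_of_cone: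
  assumes "edge_coloring (cone G) k c"
  shows "total_coloring G k c"
  unfolding total_coloring_def
proof (intro conjI ballI impI)
  show "c x < k" if "x \<in> verts G <+> edges G" for x
    using assms that by (simp add: edge_coloring_def)
  fix x y assume xy: "x \<in> verts G <+> edges G" "y \<in> verts G <+> edges G"
    "adjacent_or_incident G x y"
  then have "x \<noteq> y \<and> ends (cone G) x \<inter> ends (cone G) y \<noteq> {}"
    by (cases "(G, x, y)" rule: adjacent_or_incident.cases) auto
  then show "c x \<noteq> c y"
    using assms xy(1,2) by (simp add: edge_coloring_def)
qed

text \<open>This is the sparsity condition for the cone. The argument splits on whether
  \<open>H\<close> contains the apex; the degree condition handles one case and the given colouring
  of \<open>G\<close> the other.\<close>

lemma cone_odd_subgraph_bound:
  assumes G: "multigraph G"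
    and c: "edge_coloring G k c"
    and deg: "max_degree G + 2 \<le> k"
    and H: "subgraph H (cone G)" and odd: "odd (card (verts H))"
  shows "2 * card (edges H) \<le> k * (card (verts H) - 1)"
proof -
  \<comment> \<open>\<open>H'\<close> is the part of \<open>H\<close> inside \<open>G\<close>, and
    \<open>A\<close> collects the vertices whose spoke belongs to \<open>H\<close>.\<close>
  define H' where "H' = \<lparr>verts = {v. Some v \<in> verts H}, edges = {e. Inr e \<in> edges H},
    ends = ends G\<rparr>"
  define A where "A = {v. Inl v \<in> edges H}"
  have Inl: "None \<in> verts H \<and> Some v \<in> verts H" if "Inl v \<in> edges H" for v
    using subgraph_ends_subset[OF H that] by auto
  have Inr: "Some ` ends G e \<subseteq> verts H" if "Inr e \<in> edges H" for e
    using subgraph_ends_subset[OF H that] by auto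
  have sub: "verts H' \<subseteq> verts G" "edges H' \<subseteq> edges G"
    using H by (auto simp: H'_def subgraph_def)
  then have fin: "finite (verts H')" "finite (edges H')"
    using G by (auto simp: multigraph_def dest: finite_subset)
  have "ends G e \<subseteq> verts H'" if "e \<in> edges H'" for e
    using that Inr[of e] by (auto simp: H'_def)
  then have H': "subgraph H' G"
    using sub fin G by (auto simp: subgraph_def multigraph_def H'_def)
  have A: "A \<subseteq> verts H'"
    using Inl by (auto simp: A_def H'_def)
  have "edges H = A <+> edges H'"
  proof (rule set_eqI)
    show "x \<in> edges H \<longleftrightarrow> x \<in> A <+> edges H'" for x
      by (cases x) (auto simp: A_def H'_def)
  qed
  then have cardE: "card (edges H) = card A + card (edges H')"
    using fin finite_subset[OF A] by (simp add: card_Plus)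
  have vertsH: "verts H - {None} = Some ` verts H'"
  proof (rule set_eqI)
    show "x \<in> verts H - {None} \<longleftrightarrow> x \<in> Some ` verts H'" for x
      by (cases x) (auto simp: H'_def)
  qed
  show ?thesis
  proof (cases "None \<in> verts H")
    case True
    \<comment> \<open>The subtracted vertex is the apex itself.\<close>
    have "card (verts H) - 1 = card (verts H')"
      using True arg_cong[OF vertsH, of card] by (simp add: card_image)
    \<comment> \<open>At most one spoke per vertex of \<open>H'\<close>; counted twice, the spokes
      account for the summand 2 in \<open>max_degree G + 2\<close>.\<close>
    moreover have "2 * card A \<le> 2 * card (verts H')"
      using card_mono[OF fin(1) A] by simp
    moreover have "(max_degree G + 2) * card (verts H') \<le> k * card (verts H')"
      using deg by (rule mult_le_mono1)
    ultimately show ?thesis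
      using card_edges_subgraph_le[OF G H'] cardE by (simp add: algebra_simps)
  next
    case False
    \<comment> \<open>Without the apex there are no spokes, so \<open>H'\<close> has as many
      vertices and edges as \<open>H\<close>, and an odd number of vertices.\<close>
    then have "A = {}"
      using Inl by (auto simp: A_def)
    moreover have card: "card (verts H) = card (verts H')"
      using False arg_cong[OF vertsH, of card] by (simp add: card_image)
    ultimately show ?thesis
      using edge_coloring_odd_bound[of H' k c] edge_coloring_subgraph[OF c H'] H' odd cardE
      by (simp add: subgraph_def)
  qed
qed

text \<open>Restricting a total colouring to the edges, as \<open>c \<circ> Inr\<close>, gives an
  edge colouring.\<close>

lemma chromatic_index_le_total_chromatic_number:
  assumes "multigraph G"
  shows "chromatic_index G \<le> total_chromatic_number G"
proof -
  obtain c where c: "total_coloring G (total_chromatic_number G) c"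
    unfolding total_chromatic_number_def using LeastI_ex[OF ex_total_coloring[OF assms]] by blast
  then have "edge_coloring G (total_chromatic_number G) (c \<circ> Inr)"
    by (auto simp: total_coloring_def edge_coloring_def InrI)
  then show ?thesis
    unfolding chromatic_index_def by (blast intro: Least_le)
qed

theorem theorem1p1:
  fixes G :: "('a, 'b) mgraph"
  assumes Goldberg_Seymour:
      "\<forall>K :: (nat, nat) mgraph. multigraph K \<longrightarrow>
         chromatic_index K > max_degree K + 1 \<longrightarrow>
         int (chromatic_index K) = \<lceil>density K\<rceil>"
    and "multigraph G"
    and "chromatic_index G \<ge> max (max_degree G + 2) (card (verts G) + 1)"
  shows "total_chromatic_number G = chromatic_index G"
proof (rule antisym)
  let ?k = "chromatic_index G"
  obtain c where c: "edge_coloring G ?k c"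
    using edge_coloring_chromatic_index[OF assms(2)] by blast
  have "\<exists>c. edge_coloring (cone G) ?k c"
  proof (rule Goldberg_Seymour_transfer[OF Goldberg_Seymour multigraph_cone[OF assms(2)]])
    \<comment> \<open>The two terms of the assumed maximum exceed by one the degree bounds of the
      cone, \<open>max_degree G + 1\<close> away from the apex and \<open>card (verts G)\<close> at
      it.\<close>
    show "max_degree (cone G) < ?k"
      using max_degree_cone_le[OF assms(2)] assms(3) by simp
    show "2 * card (edges H) \<le> ?k * (card (verts H) - 1)"
      if "subgraph H (cone G)" "odd (card (verts H))" for H
      using cone_odd_subgraph_bound[OF assms(2) c _ that] assms(3) by simp
  qed
  then show "total_chromatic_number G \<le> ?k"
    unfolding total_chromatic_number_def by (blast intro: Least_le total_coloring_of_cone)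
  show "?k \<le> total_chromatic_number G"
    by (rule chromatic_index_le_total_chromatic_number[OF assms(2)])
qed

end
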